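(* Let $\mathcal{K}\subset\mathbb{R}^n$ be a compact convex set, symmetric about the origin, let $\zeta$ be uniformly distributed on $\mathcal{K}$, and let $\mathcal{X}\subset\mathbb{R}^n$ be closed, convex and bounded. Let $f(\mathbf{x})=\mathbb{P}\{\zeta : \zeta\in\mathbf{K}(\mathbf{x})\}$ with $\mathbf{K}(\mathbf{x})=\{\zeta\in\mathcal{K}: 1-|\zeta^{T}\mathbf{x}|^2\ge 0\}$. Suppose there is $\epsilon>0$ with $f(\mathbf{x})\in[\epsilon,1]$ for all $\mathbf{x}\in\mathcal{X}$, and let $h(\mathbf{x})=1/f(\mathbf{x})$. Then: (a) $h$ is convex on $\mathcal{X}$. (b) A global maximizer of $f$ over $\mathcal{X}$ is a global minimizer of $h$ over $\mathcal{X}$. *)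

theory Defs
  imports "HOL-Probability.Probability"
begin

definition strip_set :: "(real ^ 'n) set \<Rightarrow> real ^ 'n \<Rightarrow> (real ^ 'n) set" where
  "strip_set K x = {z \<in> K. 1 - \<bar>z \<bullet> x\<bar>\<^sup>2 \<ge> 0}"

text \<open>
  The random vector \<open>\<zeta>\<close>, defined on the probability space \<open>M\<close>, has law
  \<open>A \<mapsto> vol (K \<inter> A) / vol K\<close>.  If \<open>vol K = 0\<close>, then \<open>uniform_measure lborel K\<close> is the
  null measure, so on a probability space the predicate entails \<open>vol K > 0\<close>.
\<close>

definition uniformly_distributed_on ::
    "'w measure \<Rightarrow> ('w \<Rightarrow> real ^ 'n) \<Rightarrow> (real ^ 'n) set \<Rightarrow> bool" where
  "uniformly_distributed_on M \<zeta> K \<longleftrightarrow>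
     \<zeta> \<in> borel_measurable M \<and> distr M lborel \<zeta> = uniform_measure lborel K"

definition strip_prob ::
    "'w measure \<Rightarrow> ('w \<Rightarrow> real ^ 'n) \<Rightarrow> (real ^ 'n) set \<Rightarrow> real ^ 'n \<Rightarrow> real" where
  "strip_prob M \<zeta> K x = \<P>(\<omega> in M. \<zeta> \<omega> \<in> strip_set K x)"

end

theory Submission
  imports Defs
begin

text \<open>
  Up to the constant \<open>vol K\<close>, \<open>f x\<close> is the volume of the section of \<open>K \<times> [-1, 1]\<close> by the
  hyperplane with normal \<open>(x, -1)\<close>, divided by the norm of that normal.  Convexity of \<open>1 / f\<close> is
  therefore an instance of Busemann's theorem.  Concretely, let \<open>d = y - x\<close>.  By symmetry it suffices to compare the halves
  \<open>z \<bullet> d > 0\<close> of the strips of \<open>x\<close>, \<open>y\<close> and \<open>u = (1 - t) x + t y\<close>.  If \<open>z\<close> lies in the first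
  and \<open>w\<close> in the second, at heights \<open>p = z \<bullet> d\<close> and \<open>q = w \<bullet> d\<close>, then the convex combination of
  \<open>z\<close> and \<open>w\<close> with weights proportional to \<open>(1 - t) q\<close> and \<open>t p\<close> lies in the strip of \<open>u\<close>, at the
  weighted harmonic mean of the heights.  The Brunn--Minkowski inequality on the slices \<open>z \<bullet> d = r\<close>
  then reduces the claim to a one-dimensional inequality in the height \<open>r\<close>.
\<close>

section \<open>The Brunn--Minkowski inequality on the line\<close>

lemma emeasure_lborel_affine_vimage:
  fixes A :: "real set"
  assumes "0 < p" and [measurable]: "A \<in> sets borel"
  shows "emeasure lborel {u. (u - q) / p \<in> A} = ennreal p * emeasure lborel A"
proof -
  have "emeasure lborel {u. (u - q) / p \<in> A} = (\<integral>\<^sup>+u. indicator {u. (u - q) / p \<in> A} u \<partial>lborel)"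
    by simp
  also have "\<dots> = ennreal \<bar>p\<bar> * (\<integral>\<^sup>+u. indicator {u. (u - q) / p \<in> A} (q + p * u) \<partial>lborel)"
    using assms by (intro nn_integral_real_affine) auto
  also have "(\<lambda>u. indicator {u. (u - q) / p \<in> A} (q + p * u) :: ennreal) = indicator A"
    using assms by (auto simp: indicator_def)
  finally show ?thesis
    using assms by simp
qed

text \<open>Two scaled copies fit side by side: with \<open>x\<close> nearly maximal in
  \<open>A\<close> and \<open>y\<close> nearly minimal in \<open>B\<close>, the sets
  \<open>(1 - t) A + t y\<close> and \<open>(1 - t) x + t B\<close> both lie in \<open>C\<close>
  and, up to an error controlled by \<open>e\<close>, on opposite sides of
  \<open>(1 - t) * x + t * y\<close>. Hence their measures add.\<close>

lemma brunn_minkowski_real_bounded: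
  fixes A B C :: "real set" and t :: real
  assumes [measurable]: "A \<in> sets borel" "B \<in> sets borel" "C \<in> sets borel"
    and "bounded A" "bounded B" "A \<noteq> {}" "B \<noteq> {}" and t: "0 < t" "t < 1"
    and C: "\<And>a b. a \<in> A \<Longrightarrow> b \<in> B \<Longrightarrow> (1 - t) * a + t * b \<in> C"
  shows "ennreal (1 - t) * emeasure lborel A + ennreal t * emeasure lborel B \<le> emeasure lborel C"
proof (rule ennreal_le_epsilon)
  fix e :: real assume e: "0 < e"
  have bdd: "bdd_above A" "bdd_below B"
    using assms bounded_imp_bdd_above bounded_imp_bdd_below by auto
  obtain x where x: "x \<in> A" "Sup A - e < x"
    using less_cSup_iff[OF \<open>A \<noteq> {}\<close> bdd(1), of "Sup A - e"] e by auto
  obtain y where y: "y \<in> B" "y < Inf B + e"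
    using cInf_less_iff[OF \<open>B \<noteq> {}\<close> bdd(2), of "Inf B + e"] e by auto
  \<comment> \<open>Each truncation discards a piece inside an interval of length \<open>e\<close>.
    The truncations make \<open>?P\<close> and \<open>?Q\<close> disjoint; the open ray
    \<open>{y<..}\<close> keeps the meeting point \<open>(1 - t) * x + t * y\<close> out of
    \<open>?Q\<close>.\<close>
  let ?P = "{u. (u - t * y) / (1 - t) \<in> A \<inter> {..x}}"
  let ?Q = "{u. (u - (1 - t) * x) / t \<in> B \<inter> {y<..}}"
  have "emeasure lborel A \<le> emeasure lborel ((A \<inter> {..x}) \<union> {x..x+e})"
    using cSup_upper[OF _ bdd(1)] x by (intro emeasure_mono) force+
  also have "\<dots> \<le> emeasure lborel (A \<inter> {..x}) + emeasure lborel {x..x+e}"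
    by (intro emeasure_subadditive) auto
  finally have A: "emeasure lborel A \<le> emeasure lborel (A \<inter> {..x}) + ennreal e"
    using e by simp
  have "emeasure lborel B \<le> emeasure lborel ((B \<inter> {y<..}) \<union> {y-e..y})"
    using cInf_lower[OF _ bdd(2)] y by (intro emeasure_mono) force+
  also have "\<dots> \<le> emeasure lborel (B \<inter> {y<..}) + emeasure lborel {y-e..y}"
    by (intro emeasure_subadditive) auto
  finally have B: "emeasure lborel B \<le> emeasure lborel (B \<inter> {y<..}) + ennreal e"
    using e by simp
  have "ennreal (1 - t) * emeasure lborel A + ennreal t * emeasure lborel B
    \<le> ennreal (1 - t) * (emeasure lborel (A \<inter> {..x}) + ennreal e)
      + ennreal t * (emeasure lborel (B \<inter> {y<..}) + ennreal e)"
    by (intro add_mono mult_left_mono A B) auto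
  also have "\<dots> = ennreal (1 - t) * emeasure lborel (A \<inter> {..x})
      + ennreal t * emeasure lborel (B \<inter> {y<..}) + (ennreal (1 - t) * ennreal e + ennreal t * ennreal e)"
    by (simp add: distrib_left add.assoc add.left_commute)
  also have "ennreal (1 - t) * ennreal e + ennreal t * ennreal e = ennreal e"
    using t e by (simp add: algebra_simps flip: ennreal_mult ennreal_plus)
  also have "ennreal (1 - t) * emeasure lborel (A \<inter> {..x}) = emeasure lborel ?P"
    using t by (intro emeasure_lborel_affine_vimage[symmetric]) auto
  also have "ennreal t * emeasure lborel (B \<inter> {y<..}) = emeasure lborel ?Q"
    using t by (intro emeasure_lborel_affine_vimage[symmetric]) auto
  also have "emeasure lborel ?P + emeasure lborel ?Q = emeasure lborel (?P \<union> ?Q)"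
  proof (rule plus_emeasure)
    show "?P \<inter> ?Q = {}"
      using t by (auto simp: field_simps)
  qed simp_all
  also have "\<dots> \<le> emeasure lborel C"
  proof (intro emeasure_mono subsetI)
    fix u assume "u \<in> ?P \<union> ?Q"
    then show "u \<in> C"
    proof
      assume "u \<in> ?P"
      then show ?thesis using C[of "(u - t * y) / (1 - t)" y] y t by simp
    next
      assume "u \<in> ?Q"
      then show ?thesis using C[of x "(u - (1 - t) * x) / t"] x t by simp
    qed
  qed simp
  finally show "ennreal (1 - t) * emeasure lborel A + ennreal t * emeasure lborel B
    \<le> emeasure lborel C + ennreal e"
    by (simp add: add_right_mono)
qed

text \<open>Exhaustion by the intervals \<open>{- n..n}\<close> and continuity of measure from below
  reduce this to bounded sets.\<close>

lemma brunn_minkowski_real: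
  fixes A B C :: "real set" and t :: real
  assumes [measurable]: "A \<in> sets borel" "B \<in> sets borel" "C \<in> sets borel"
    and "A \<noteq> {}" "B \<noteq> {}" and t: "0 < t" "t < 1"
    and C: "\<And>a b. a \<in> A \<Longrightarrow> b \<in> B \<Longrightarrow> (1 - t) * a + t * b \<in> C"
  shows "ennreal (1 - t) * emeasure lborel A + ennreal t * emeasure lborel B \<le> emeasure lborel C"
proof (rule LIMSEQ_le_const2)
  let ?c = "\<lambda>n. {- real n..real n}"
  have lim: "(\<lambda>n. emeasure lborel (D \<inter> ?c n)) \<longlonglongrightarrow> emeasure lborel D"
    if [measurable]: "D \<in> sets borel" for D :: "real set"
  proof -
    have "(\<lambda>n. emeasure lborel (D \<inter> ?c n)) \<longlonglongrightarrow> emeasure lborel (\<Union>n. D \<inter> ?c n)"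
      by (intro Lim_emeasure_incseq) (auto simp: incseq_def)
    moreover have "(\<Union>n. D \<inter> ?c n) = D"
    proof safe
      fix x assume "x \<in> D"
      moreover obtain n :: nat where "\<bar>x\<bar> \<le> real n"
        using real_arch_simple by blast
      ultimately show "x \<in> (\<Union>n. D \<inter> ?c n)"
        by (auto intro!: exI[of _ n])
    qed
    ultimately show ?thesis by simp
  qed
  show "(\<lambda>n. ennreal (1 - t) * emeasure lborel (A \<inter> ?c n) + ennreal t * emeasure lborel (B \<inter> ?c n))
    \<longlonglongrightarrow> ennreal (1 - t) * emeasure lborel A + ennreal t * emeasure lborel B"
    using t by (intro tendsto_add ennreal_tendsto_cmult lim) auto
  obtain a b where ab: "a \<in> A" "b \<in> B"
    using assms by auto
  \<comment> \<open>From \<open>N\<close> on the truncations still contain \<open>a\<close> and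
    \<open>b\<close>, so the bounded case is applied to nonempty sets.\<close>
  obtain N :: nat where N: "max \<bar>a\<bar> \<bar>b\<bar> \<le> real N"
    using real_arch_simple by blast
  show "\<exists>N. \<forall>n\<ge>N. ennreal (1 - t) * emeasure lborel (A \<inter> ?c n)
      + ennreal t * emeasure lborel (B \<inter> ?c n) \<le> emeasure lborel C"
  proof (intro exI[of _ N] allI impI)
    fix n assume "N \<le> n"
    then have "a \<in> ?c n" "b \<in> ?c n"
      using N by auto
    then show "ennreal (1 - t) * emeasure lborel (A \<inter> ?c n)
      + ennreal t * emeasure lborel (B \<inter> ?c n) \<le> emeasure lborel C"
      using ab t C by (intro brunn_minkowski_real_bounded) auto
  qed
qed

section \<open>Comparison of integrals through level sets\<close>

text \<open>Both sides compute the area of the region \<open>0 \<le> s < f x\<close>, by Tonelli in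
  either order; the factor \<open>indicator {0..} s\<close> discards negative levels.\<close>

lemma nn_integral_layer_cake:
  fixes f :: "real \<Rightarrow> real"
  assumes [measurable]: "f \<in> borel_measurable borel" and "\<And>x. 0 \<le> f x"
  shows "(\<integral>\<^sup>+x. ennreal (f x) \<partial>lborel)
    = (\<integral>\<^sup>+s. emeasure lborel {x. s < f x} * indicator {0..} s \<partial>lborel)"
proof -
  have "(\<integral>\<^sup>+x. ennreal (f x) \<partial>lborel)
    = (\<integral>\<^sup>+x. (\<integral>\<^sup>+s. indicator {p. snd p < f (fst p) \<and> 0 \<le> snd p} (x, s) \<partial>lborel) \<partial>lborel)"
  proof (rule nn_integral_cong)
    fix x
    have "(\<lambda>s. indicator {p. snd p < f (fst p) \<and> 0 \<le> snd p} (x, s) :: ennreal) = indicator {0..<f x}"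
      by (auto simp: indicator_def)
    then show "ennreal (f x) = (\<integral>\<^sup>+s. indicator {p. snd p < f (fst p) \<and> 0 \<le> snd p} (x, s) \<partial>lborel)"
      using assms(2)[of x] by simp
  qed
  also have "\<dots> = (\<integral>\<^sup>+s. (\<integral>\<^sup>+x. indicator {p. snd p < f (fst p) \<and> 0 \<le> snd p} (x, s) \<partial>lborel) \<partial>lborel)"
    by (intro lborel_pair.Fubini' [symmetric]) measurable
  also have "\<dots> = (\<integral>\<^sup>+s. emeasure lborel {x. s < f x} * indicator {0..} s \<partial>lborel)"
  proof (rule nn_integral_cong)
    fix s :: real
    have "(\<lambda>x. indicator {p. snd p < f (fst p) \<and> 0 \<le> snd p} (x, s) :: ennreal)
      = (\<lambda>x. indicator {x. s < f x} x * indicator {0..} s)"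
      by (auto simp: indicator_def)
    then show "(\<integral>\<^sup>+x. indicator {p. snd p < f (fst p) \<and> 0 \<le> snd p} (x, s) \<partial>lborel)
      = emeasure lborel {x. s < f x} * indicator {0..} s"
      by (simp add: nn_integral_multc)
  qed
  finally show ?thesis .
qed

text \<open>
  The normalisation by the suprema makes the level sets of \<open>f / S\<close> and \<open>g / T\<close> nonempty
  for the same levels, which is what the one-dimensional Brunn--Minkowski inequality needs.
\<close>

lemma nn_integral_ge_of_level_sets:
  fixes f g h :: "real \<Rightarrow> real" and c S T t :: real
  assumes [measurable]: "f \<in> borel_measurable borel" "g \<in> borel_measurable borel"
      "h \<in> borel_measurable borel"
    and nonneg: "\<And>x. 0 \<le> f x" "\<And>x. 0 \<le> g x" "\<And>x. 0 \<le> h x"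
    and S: "0 < S" "\<And>x. f x \<le> S" "\<And>s. s < S \<Longrightarrow> \<exists>x. s < f x"
    and T: "0 < T" "\<And>x. g x \<le> T" "\<And>s. s < T \<Longrightarrow> \<exists>x. s < g x"
    and c: "0 < c" and t: "0 < t" "t < 1"
    and h: "\<And>x y. 0 < f x \<Longrightarrow> 0 < g y \<Longrightarrow> c * min (f x / S) (g y / T) \<le> h ((1 - t) * x + t * y)"
  shows "ennreal ((1 - t) * c / S) * (\<integral>\<^sup>+x. f x \<partial>lborel) + ennreal (t * c / T) * (\<integral>\<^sup>+x. g x \<partial>lborel)
    \<le> (\<integral>\<^sup>+x. h x \<partial>lborel)"
proof -
  let ?e = "\<lambda>F s. emeasure lborel {x. s < F x} * indicator {0..} (s::real) :: ennreal"
  let ?f = "\<lambda>x. f x / S" and ?g = "\<lambda>x. g x / T" and ?h = "\<lambda>x. h x / c"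
  \<comment> \<open>The integrands are compared level by level; for \<open>s\<close> in
    \<open>[0, 1)\<close> the claim is the one-dimensional Brunn--Minkowski inequality.\<close>
  have "ennreal (1 - t) * ?e ?f s + ennreal t * ?e ?g s \<le> ?e ?h s" for s
  proof (cases "0 \<le> s \<and> s < 1")
    case True
    have "s * S < S" "s * T < T" using True S T by auto
    then obtain x y where xy: "s * S < f x" "s * T < g y"
      using S(3)[of "s * S"] T(3)[of "s * T"] by auto
    have "ennreal (1 - t) * emeasure lborel {x. s < ?f x} + ennreal t * emeasure lborel {x. s < ?g x}
      \<le> emeasure lborel {x. s < ?h x}"
    proof (rule brunn_minkowski_real[OF _ _ _ _ _ t])
      show "{x. s < ?f x} \<noteq> {}" "{x. s < ?g x} \<noteq> {}"
        using S T xy by (auto simp: field_simps)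
      fix a b assume ab: "a \<in> {x. s < ?f x}" "b \<in> {x. s < ?g x}"
      then have "0 < ?f a" "0 < ?g b" using True by auto
      then have "0 < f a" "0 < g b" using S T by (auto simp: zero_less_divide_iff)
      then have "c * min (?f a) (?g b) \<le> h ((1 - t) * a + t * b)"
        using h by blast
      moreover have "c * s < c * min (?f a) (?g b)"
        using ab c by simp
      ultimately have "c * s < h ((1 - t) * a + t * b)"
        by linarith
      then show "(1 - t) * a + t * b \<in> {x. s < ?h x}"
        using c by (simp add: pos_less_divide_eq mult.commute)
    qed auto
    then show ?thesis using True by simp
  next
    case False
    \<comment> \<open>For \<open>s \<ge> 1\<close> the level sets of \<open>f / S\<close> and
      \<open>g / T\<close> are empty, and for \<open>s < 0\<close> the indicator vanishes, so the
      left side is 0 in both cases.\<close>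
    have e: "?f x \<le> 1" "?g x \<le> 1" for x using S T by (auto simp: field_simps)
    have "{x. s < ?f x} = {}" "{x. s < ?g x} = {}" if "1 \<le> s"
      using that order_trans[OF e(1) that] order_trans[OF e(2) that] by (auto simp: not_less)
    then show ?thesis using False by (cases "0 \<le> s") auto
  qed
  then have "(\<integral>\<^sup>+s. ennreal (1 - t) * ?e ?f s + ennreal t * ?e ?g s \<partial>lborel) \<le> (\<integral>\<^sup>+s. ?e ?h s \<partial>lborel)"
    by (intro nn_integral_mono)
  also have "(\<integral>\<^sup>+s. ennreal (1 - t) * ?e ?f s + ennreal t * ?e ?g s \<partial>lborel)
    = ennreal (1 - t) * (\<integral>\<^sup>+s. ?e ?f s \<partial>lborel) + ennreal t * (\<integral>\<^sup>+s. ?e ?g s \<partial>lborel)"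
    by (simp add: nn_integral_add nn_integral_cmult)
  also have "(\<integral>\<^sup>+s. ?e ?f s \<partial>lborel) = (\<integral>\<^sup>+x. ennreal (?f x) \<partial>lborel)"
    using S nonneg by (intro nn_integral_layer_cake[symmetric]) auto
  also have "(\<integral>\<^sup>+s. ?e ?g s \<partial>lborel) = (\<integral>\<^sup>+x. ennreal (?g x) \<partial>lborel)"
    using T nonneg by (intro nn_integral_layer_cake[symmetric]) auto
  also have "(\<integral>\<^sup>+s. ?e ?h s \<partial>lborel) = (\<integral>\<^sup>+x. ennreal (?h x) \<partial>lborel)"
    using c nonneg by (intro nn_integral_layer_cake[symmetric]) auto
  finally have "ennreal c * (ennreal (1 - t) * (\<integral>\<^sup>+x. ennreal (?f x) \<partial>lborel)
      + ennreal t * (\<integral>\<^sup>+x. ennreal (?g x) \<partial>lborel)) \<le> ennreal c * (\<integral>\<^sup>+x. ennreal (?h x) \<partial>lborel)"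
    by (intro mult_left_mono) auto
  moreover have scale: "(\<integral>\<^sup>+x. ennreal (F x / p) \<partial>lborel) = ennreal (1 / p) * (\<integral>\<^sup>+x. ennreal (F x) \<partial>lborel)"
    if [measurable]: "F \<in> borel_measurable borel" and "0 < p" for F :: "real \<Rightarrow> real" and p
    using that by (subst nn_integral_cmult[symmetric]) (auto simp flip: ennreal_mult')
  moreover have "ennreal c * (ennreal (1 / c) * u) = u" for u
    using c by (simp add: mult.assoc[symmetric] flip: ennreal_mult)
  ultimately show ?thesis
    using c S T t by (simp add: scale distrib_left mult.assoc[symmetric] flip: ennreal_mult)
      (simp add: mult.commute)
qed

section \<open>Prekopa--Leindler and Borell inequalities on the line\<close>

text \<open>A vanishing supremum would force \<open>f = 0\<close>, against the positive integral.
  The last property, that values of \<open>f\<close> come arbitrarily close to \<open>S\<close>, is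
  what makes level sets below \<open>S\<close> nonempty.\<close>

lemma bounded_density_supremum:
  fixes f :: "real \<Rightarrow> real"
  assumes nonneg: "\<And>x. 0 \<le> f x" and bound: "\<And>x. f x \<le> b"
    and I: "(\<integral>\<^sup>+x. f x \<partial>lborel) = ennreal I" "0 < I"
  obtains S where "0 < S" "\<And>x. f x \<le> S" "\<And>s. s < S \<Longrightarrow> \<exists>x. s < f x"
proof -
  have bdd: "bdd_above (range f)"
    using bound by (intro bdd_aboveI[of _ b]) auto
  have "\<exists>x. 0 < f x"
  proof (rule ccontr)
    assume "\<not> (\<exists>x. 0 < f x)"
    then have "f = (\<lambda>x. 0)"
      using nonneg by (auto simp: not_less intro: antisym)
    then show False using I by simp
  qed
  then obtain x where "0 < f x" ..
  then have "0 < (SUP x. f x)"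
    using cSUP_upper[OF UNIV_I bdd, of x] by linarith
  moreover have "f x \<le> (SUP x. f x)" for x
    using cSUP_upper[OF UNIV_I bdd] .
  moreover have "\<exists>x. s < f x" if "s < (SUP x. f x)" for s
    using that less_cSUP_iff[OF _ bdd, of s] by auto
  ultimately show thesis using that by blast
qed

text \<open>As the exponents sum to 1, the minimum is the product of its own powers with exponents
  \<open>a\<close> and \<open>b\<close>, and each power is monotone in its base.\<close>

lemma powr_mult_powr_ge_min:
  fixes x y a b :: real
  assumes "0 \<le> x" "0 \<le> y" "0 \<le> a" "0 \<le> b" "a + b = 1"
  shows "min x y \<le> x powr a * y powr b"
proof (cases "min x y = 0")
  case True
  then show ?thesis by (simp only: True) simp
next
  case False
  then have "min x y = min x y powr a * min x y powr b"
    using assms by (simp flip: powr_add)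
  also have "\<dots> \<le> x powr a * y powr b"
    using assms by (intro mult_mono powr_mono2) auto
  finally show ?thesis .
qed

text \<open>The level-set inequality bounds \<open>H\<close> below by an arithmetic mean of the
  normalised integrals \<open>I / S\<close> and \<open>J / T\<close>, and Young's inequality passes
  to the geometric mean. The bound \<open>b\<close> keeps the suprema \<open>S\<close> and
  \<open>T\<close> finite.\<close>

lemma prekopa_leindler_real:
  fixes f g h :: "real \<Rightarrow> real"
  assumes meas: "f \<in> borel_measurable borel" "g \<in> borel_measurable borel"
      "h \<in> borel_measurable borel"
    and nonneg: "\<And>x. 0 \<le> f x" "\<And>x. 0 \<le> g x" "\<And>x. 0 \<le> h x"
    and bound: "\<And>x. f x \<le> b" "\<And>x. g x \<le> b"
    and int: "(\<integral>\<^sup>+x. f x \<partial>lborel) = ennreal I" "(\<integral>\<^sup>+x. g x \<partial>lborel) = ennreal J"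
      "(\<integral>\<^sup>+x. h x \<partial>lborel) = ennreal H"
    and IJH: "0 \<le> I" "0 \<le> J" "0 \<le> H" and t: "0 < t" "t < 1"
    and h: "\<And>x y. f x powr (1 - t) * g y powr t \<le> h ((1 - t) * x + t * y)"
  shows "I powr (1 - t) * J powr t \<le> H"
proof (cases "I = 0 \<or> J = 0")
  case True
  then show ?thesis using IJH by auto
next
  case False
  then have IJ: "0 < I" "0 < J" using IJH by auto
  obtain S where S: "0 < S" "\<And>x. f x \<le> S" "\<And>s. s < S \<Longrightarrow> \<exists>x. s < f x"
    using bounded_density_supremum[OF nonneg(1) bound(1) int(1) IJ(1)] by blast
  obtain T where T: "0 < T" "\<And>x. g x \<le> T" "\<And>s. s < T \<Longrightarrow> \<exists>x. s < g x"
    using bounded_density_supremum[OF nonneg(2) bound(2) int(2) IJ(2)] by blast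
  \<comment> \<open>With this value the normalisations by \<open>S\<close> and \<open>T\<close>
    cancel in the geometric means, first of \<open>f\<close> and \<open>g\<close> and at the end of
    \<open>I\<close> and \<open>J\<close>.\<close>
  define c where "c = S powr (1 - t) * T powr t"
  have c: "0 < c" using S T by (simp add: c_def)
  have "c * min (f x / S) (g y / T) \<le> h ((1 - t) * x + t * y)" for x y
  proof -
    have "c * min (f x / S) (g y / T) \<le> c * ((f x / S) powr (1 - t) * (g y / T) powr t)"
      using S T c t nonneg by (intro mult_left_mono powr_mult_powr_ge_min) auto
    also have "\<dots> = f x powr (1 - t) * g y powr t"
      using S T nonneg by (simp add: c_def powr_divide)
    finally show ?thesis using h order_trans by blast
  qed
  then have "ennreal ((1 - t) * c / S) * (\<integral>\<^sup>+x. f x \<partial>lborel) + ennreal (t * c / T) * (\<integral>\<^sup>+x. g x \<partial>lborel)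
      \<le> (\<integral>\<^sup>+x. h x \<partial>lborel)"
    by (intro nn_integral_ge_of_level_sets[OF meas nonneg S T c t]) auto
  then have "ennreal ((1 - t) * c / S * I + t * c / T * J) \<le> ennreal H"
    using S T c t IJ by (simp add: int ennreal_mult ennreal_plus del: times_divide_eq_left)
  then have *: "(1 - t) * c / S * I + t * c / T * J \<le> H"
    using IJH by simp
  have "I powr (1 - t) * J powr t = c * ((I / S) powr (1 - t) * (J / T) powr t)"
    using S T IJ by (simp add: c_def powr_divide)
  also have "\<dots> \<le> c * ((1 - t) * (I / S) + t * (J / T))"
    using S T IJ t c by (intro mult_left_mono Youngs_inequality_0) auto
  also have "\<dots> = (1 - t) * c / S * I + t * c / T * J"
    by (simp add: algebra_simps)
  finally show ?thesis using * by linarith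
qed

section \<open>Reciprocal substitution and harmonic means of integrals\<close>

text \<open>This is the change of variables \<open>x = 1 / u\<close> on the positive half-line, with
  Jacobian \<open>1 / u\<^sup>2\<close>. It is carried out for absolutely integrable functions,
  hence the passage from the nonnegative integral and back.\<close>

lemma nn_integral_inverse_substitution:
  fixes F :: "real \<Rightarrow> real"
  assumes [measurable]: "F \<in> borel_measurable borel"
    and nonneg: "\<And>x. 0 \<le> F x" and zero: "\<And>x. x \<le> 0 \<Longrightarrow> F x = 0"
    and int: "(\<integral>\<^sup>+x. F x \<partial>lborel) = ennreal I" and I: "0 \<le> I"
  shows "(\<integral>\<^sup>+u. ennreal (if 0 < u then F (1 / u) / u\<^sup>2 else 0) \<partial>lborel) = ennreal I"
proof -
  have "(F has_integral I) UNIV"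
    by (intro nn_integral_has_integral assms)
  moreover have "F = (\<lambda>x. if x \<in> {0<..} then F x else 0)"
    using zero by (auto simp: fun_eq_iff)
  ultimately have FI: "(F has_integral I) {0<..}"
    by (metis has_integral_restrict_UNIV)
  have img: "(\<lambda>x::real. 1 / x) ` {0<..} = {0<..}"
  proof (intro equalityI subsetI)
    fix x :: real assume "x \<in> {0<..}"
    then show "x \<in> (\<lambda>x. 1 / x) ` {0<..}"
      by (intro image_eqI[of _ _ "1 / x"]) auto
  qed auto
  have "F absolutely_integrable_on (\<lambda>x. 1 / x) ` {0<..} \<and> integral ((\<lambda>x. 1 / x) ` {0<..}) F = I"
    unfolding img using FI nonneg
    by (auto intro!: nonnegative_absolutely_integrable_1 simp: has_integral_integrable integral_unique)
  moreover have "((\<lambda>x. 1 / x) has_field_derivative - (1 / x\<^sup>2)) (at x within {0<..})"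
    if "x \<in> {0<..}" for x :: real
    using that by (auto intro!: derivative_eq_intros simp: power2_eq_square divide_simps)
  moreover have "inj_on (\<lambda>x::real. 1 / x) {0<..}"
    by (auto simp: inj_on_def)
  ultimately have "(\<lambda>x. \<bar>- (1 / x\<^sup>2)\<bar> * F (1 / x)) absolutely_integrable_on {0<..} \<and>
      integral {0<..} (\<lambda>x. \<bar>- (1 / x\<^sup>2)\<bar> * F (1 / x)) = I"
    by (subst has_absolute_integral_change_of_variables_1') auto
  then have "((\<lambda>x. \<bar>- (1 / x\<^sup>2)\<bar> * F (1 / x)) has_integral I) {0<..}"
    using set_lebesgue_integral_eq_integral(1) has_integral_integral by blast
  then have "(\<integral>\<^sup>+x. ennreal (\<bar>- (1 / x\<^sup>2)\<bar> * F (1 / x)) * indicator {0<..} x \<partial>lborel) = ennreal I"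
    using nonneg by (intro nn_integral_has_integral_lebesgue') auto
  also have "(\<integral>\<^sup>+x. ennreal (\<bar>- (1 / x\<^sup>2)\<bar> * F (1 / x)) * indicator {0<..} x \<partial>lborel)
    = (\<integral>\<^sup>+u. ennreal (if 0 < u then F (1 / u) / u\<^sup>2 else 0) \<partial>lborel)"
    by (intro nn_integral_cong) (auto simp: indicator_def)
  finally show ?thesis .
qed

text \<open>
  The substitution \<open>u = 1 / r\<close> turns the harmonic mean of the arguments into an arithmetic one.
  The densities \<open>F (1 / u) / u\<^sup>2\<close> then satisfy the hypothesis of Borell's inequality with exponent
  \<open>-1/2\<close>, and this exponent yields the harmonic mean of the integrals.
\<close>

lemma harmonic_mean_integral:
  fixes F G H :: "real \<Rightarrow> real"
  assumes [measurable]: "F \<in> borel_measurable borel" "G \<in> borel_measurable borel"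
      "H \<in> borel_measurable borel"
    and nonneg: "\<And>x. 0 \<le> F x" "\<And>x. 0 \<le> G x" "\<And>x. 0 \<le> H x"
    and zero: "\<And>x. x \<le> 0 \<Longrightarrow> F x = 0" "\<And>x. x \<le> 0 \<Longrightarrow> G x = 0" "\<And>x. x \<le> 0 \<Longrightarrow> H x = 0"
    and bound: "\<And>x. F x \<le> b" "\<And>x. G x \<le> b"
    and supp: "\<And>x. R < x \<Longrightarrow> F x = 0" "\<And>x. R < x \<Longrightarrow> G x = 0"
    and int: "(\<integral>\<^sup>+x. F x \<partial>lborel) = ennreal I" "(\<integral>\<^sup>+x. G x \<partial>lborel) = ennreal J"
      "(\<integral>\<^sup>+x. H x \<partial>lborel) = ennreal L"
    and IJL: "0 < I" "0 < J" "0 \<le> L" and t: "0 < t" "t < 1"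
    and H: "\<And>x y D. 0 < x \<Longrightarrow> 0 < y \<Longrightarrow> D = (1 - t) * y + t * x \<Longrightarrow>
      F x powr ((1 - t) * y / D) * G y powr (t * x / D) \<le> H (x * y / D)"
  shows "I * J \<le> L * ((1 - t) * J + t * I)"
proof -
  define f where "f = (\<lambda>K u::real. if 0 < u then K (1 / u) / u\<^sup>2 else (0::real))"
  have meas: "f F \<in> borel_measurable borel" "f G \<in> borel_measurable borel"
      "f H \<in> borel_measurable borel"
    unfolding f_def by measurable
  have f0: "0 \<le> f F x" "0 \<le> f G x" "0 \<le> f H x" for x
    using nonneg by (auto simp: f_def)
  have b: "0 \<le> b" using nonneg bound order_trans by blast
  \<comment> \<open>Small \<open>u\<close> correspond to large arguments \<open>1 / u\<close>, where
    \<open>K\<close> vanishes; the bound \<open>R\<close> on the support thus controls the factor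
    \<open>1 / u\<^sup>2\<close>.\<close>
  have fb: "f K u \<le> b * R\<^sup>2"
    if K: "\<And>x. K x \<le> b" "\<And>x. R < x \<Longrightarrow> K x = 0" for K u
  proof (cases "0 < u \<and> 1 / u \<le> R")
    case True
    have "f K u = K (1 / u) * (1 / u)\<^sup>2"
      using True by (simp add: f_def power_divide)
    also have "\<dots> \<le> b * R\<^sup>2"
      using True K b by (intro mult_mono power_mono) auto
    finally show ?thesis .
  next
    case False
    then have "f K u = 0" using K(2)[of "1 / u"] by (auto simp: f_def)
    then show ?thesis using b by simp
  qed
  have int': "(\<integral>\<^sup>+x. f F x \<partial>lborel) = ennreal I" "(\<integral>\<^sup>+x. f G x \<partial>lborel) = ennreal J"
      "(\<integral>\<^sup>+x. f H x \<partial>lborel) = ennreal L"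
    unfolding f_def using nonneg zero int IJL by (auto intro!: nn_integral_inverse_substitution)
  obtain S where S: "0 < S" "\<And>x. f F x \<le> S" "\<And>s. s < S \<Longrightarrow> \<exists>x. s < f F x"
    using bounded_density_supremum[OF f0(1) fb[OF bound(1) supp(1)] int'(1) IJL(1)] by blast
  obtain T where T: "0 < T" "\<And>x. f G x \<le> T" "\<And>s. s < T \<Longrightarrow> \<exists>x. s < f G x"
    using bounded_density_supremum[OF f0(2) fb[OF bound(2) supp(2)] int'(2) IJL(2)] by blast
  \<comment> \<open>\<open>P\<close> and \<open>Q\<close> are the suprema raised to the power
    \<open>-1/2\<close>, so \<open>1 / N\<^sup>2\<close> is the weighted power mean of
    \<open>S\<close> and \<open>T\<close> with exponent \<open>-1/2\<close>. It serves as the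
    constant \<open>c\<close> of \<open>nn_integral_ge_of_level_sets\<close>.\<close>
  define P Q where "P = 1 / sqrt S" and "Q = 1 / sqrt T"
  define N where "N = (1 - t) * P + t * Q"
  have PQ: "0 < P" "0 < Q" using S T by (auto simp: P_def Q_def)
  have ST: "S = 1 / P\<^sup>2" "T = 1 / Q\<^sup>2"
    using S T by (auto simp: P_def Q_def power_divide)
  have N: "0 < N" using PQ t by (auto simp: N_def intro!: add_pos_pos)
  have key: "1 / N\<^sup>2 * min (f F u / S) (f G v / T) \<le> f H ((1 - t) * u + t * v)"
    if "0 < f F u" "0 < f G v" for u v
  proof -
    have uv: "0 < u" "0 < v" using that by (auto simp: f_def split: if_splits)
    define w where "w = (1 - t) * u + t * v"
    have w: "0 < w" using uv t by (auto simp: w_def intro!: add_pos_pos)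
    \<comment> \<open>These are the weights in the hypothesis on \<open>H\<close> at
      \<open>x = 1 / u\<close> and \<open>y = 1 / v\<close>: there \<open>D = w / (u * v)\<close>
      and \<open>x * y / D = 1 / w\<close>.\<close>
    define p q where "p = (1 - t) * u / w" and "q = t * v / w"
    have pq: "0 \<le> p" "0 \<le> q" "p + q = 1"
      using uv t w by (auto simp: p_def q_def w_def simp flip: add_divide_distrib)
    define m where "m = min (f F u / S) (f G v / T)"
    have m: "0 < m" using that S T by (simp add: m_def)
    have Fu: "F (1 / u) = f F u * u\<^sup>2" "G (1 / v) = f G v * v\<^sup>2"
      using uv by (simp_all add: f_def)
    have Dw: "(1 - t) * (1 / v) + t * (1 / u) = w / (u * v)"
      using uv by (simp add: w_def field_simps)
    have "F (1 / u) powr p * G (1 / v) powr q \<le> H (1 / w)"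
      using H[of "1 / u" "1 / v" "w / (u * v)"] uv w Dw by (simp add: p_def q_def mult.commute)
    \<comment> \<open>The choice of \<open>m\<close> gives \<open>m * S \<le> f F u\<close>;
      multiplying by \<open>u\<^sup>2\<close> and writing \<open>S\<close> as
      \<open>1 / P\<^sup>2\<close> yields the bound.\<close>
    moreover have "m * (u / P)\<^sup>2 \<le> F (1 / u)"
      using m S uv unfolding Fu ST(1) m_def
      by (auto simp: power_divide min_def field_simps)
    then have "(m * (u / P)\<^sup>2) powr p \<le> F (1 / u) powr p"
      using m pq by (intro powr_mono2) auto
    moreover have "m * (v / Q)\<^sup>2 \<le> G (1 / v)"
      using m T uv unfolding Fu ST(2) m_def
      by (auto simp: power_divide min_def field_simps)
    then have "(m * (v / Q)\<^sup>2) powr q \<le> G (1 / v) powr q"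
      using m pq by (intro powr_mono2) auto
    ultimately have 1: "(m * (u / P)\<^sup>2) powr p * (m * (v / Q)\<^sup>2) powr q \<le> H (1 / w)"
      by (meson mult_mono order_trans powr_ge_zero)
    have sq: "((x::real)\<^sup>2) powr y = (x powr y)\<^sup>2" if "0 < x" for x y
      using that by (simp add: powr_powr mult.commute flip: powr_numeral)
    have mm: "m powr p * m powr q = m"
      using m pq by (simp flip: powr_add)
    have "(m * (u / P)\<^sup>2) powr p * (m * (v / Q)\<^sup>2) powr q
      = (m powr p * m powr q) * ((u / P) powr p * (v / Q) powr q)\<^sup>2"
      using m uv PQ by (simp add: powr_mult sq power_mult_distrib)
    then have 2: "(m * (u / P)\<^sup>2) powr p * (m * (v / Q)\<^sup>2) powr q
      = m * ((u / P) powr p * (v / Q) powr q)\<^sup>2"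
      by (simp only: mm)
    \<comment> \<open>Young's inequality is applied to the reciprocals because a lower bound is
      wanted: the geometric mean of \<open>u / P\<close> and \<open>v / Q\<close> dominates their
      harmonic mean \<open>w / N\<close>.\<close>
    have "(P / u) powr p * (Q / v) powr q \<le> p * (P / u) + q * (Q / v)"
      using pq uv PQ by (intro Youngs_inequality_0) auto
    also have "\<dots> = N / w"
      using uv w by (simp add: p_def q_def N_def field_simps)
    finally have 3: "(P / u) powr p * (Q / v) powr q \<le> N / w" .
    have "w / N \<le> (u / P) powr p * (v / Q) powr q"
    proof -
      have "(u / P) powr p * (v / Q) powr q = 1 / ((P / u) powr p * (Q / v) powr q)"
        using uv PQ by (simp add: powr_divide)
      moreover have "1 / (N / w) \<le> 1 / ((P / u) powr p * (Q / v) powr q)"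
        using 3 uv PQ by (intro divide_left_mono) (auto intro!: mult_pos_pos N w divide_pos_pos)
      ultimately show ?thesis by simp
    qed
    then have "m * (w / N)\<^sup>2 \<le> m * ((u / P) powr p * (v / Q) powr q)\<^sup>2"
      using m w N by (intro mult_left_mono power_mono) auto
    then have "m * (w / N)\<^sup>2 \<le> H (1 / w)" using 1 2 by linarith
    then have "m / N\<^sup>2 \<le> H (1 / w) / w\<^sup>2"
      using w N by (simp add: field_simps)
    then show ?thesis using w by (simp add: f_def m_def w_def[symmetric])
  qed
  have "ennreal ((1 - t) * (1 / N\<^sup>2) / S) * (\<integral>\<^sup>+x. f F x \<partial>lborel)
      + ennreal (t * (1 / N\<^sup>2) / T) * (\<integral>\<^sup>+x. f G x \<partial>lborel) \<le> (\<integral>\<^sup>+x. f H x \<partial>lborel)"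
    using N by (intro nn_integral_ge_of_level_sets[OF meas f0 S T _ t key]) auto
  then have "ennreal ((1 - t) * (1 / N\<^sup>2) / S * I + t * (1 / N\<^sup>2) / T * J) \<le> ennreal L"
    using S T t IJL by (simp add: int' ennreal_mult ennreal_plus del: times_divide_eq_left)
  then have "(1 - t) * (1 / N\<^sup>2) / S * I + t * (1 / N\<^sup>2) / T * J \<le> L"
    using IJL by simp
  then have "(1 - t) * P\<^sup>2 * I + t * Q\<^sup>2 * J \<le> L * N\<^sup>2"
    unfolding ST using N by (simp add: field_simps)
  then have "((1 - t) * P\<^sup>2 * I + t * Q\<^sup>2 * J) * ((1 - t) * J + t * I)
      \<le> L * N\<^sup>2 * ((1 - t) * J + t * I)"
    using IJL t by (intro mult_right_mono) auto
  \<comment> \<open>Cauchy--Schwarz with its exact remainder; it eliminates the unknown suprema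
    behind \<open>P\<close> and \<open>Q\<close>.\<close>
  moreover have "((1 - t) * P\<^sup>2 * I + t * Q\<^sup>2 * J) * ((1 - t) * J + t * I) - N\<^sup>2 * (I * J)
      = t * (1 - t) * (P * I - Q * J)\<^sup>2"
    unfolding N_def by algebra
  moreover have "0 \<le> t * (1 - t) * (P * I - Q * J)\<^sup>2"
    using t by simp
  ultimately have "N\<^sup>2 * (I * J) \<le> N\<^sup>2 * (L * ((1 - t) * J + t * I))"
    by (simp add: mult_ac)
  then show ?thesis
    using N by simp
qed

section \<open>The Brunn--Minkowski inequality for product measures\<close>

interpretation lborel_product: product_sigma_finite "\<lambda>_. lborel :: real measure"
  by standard

abbreviation lborel_PiM :: "'i set \<Rightarrow> ('i \<Rightarrow> real) measure" where
  "lborel_PiM I \<equiv> Pi\<^sub>M I (\<lambda>_. lborel)"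

lemma emeasure_lborel_PiM_finite:
  assumes "finite I" "A \<subseteq> (\<Pi>\<^sub>E i\<in>I. {- R..R})"
  shows "emeasure (lborel_PiM I) A < \<infinity>"
proof -
  have "emeasure (lborel_PiM I) A \<le> emeasure (lborel_PiM I) (\<Pi>\<^sub>E i\<in>I. {- R..R})"
    using assms by (intro emeasure_mono sets_PiM_I_finite) auto
  also have "\<dots> = (\<Prod>i\<in>I. emeasure lborel {- R..R})"
    using assms by (intro lborel_product.emeasure_PiM) auto
  also have "\<dots> < \<infinity>"
    by (simp add: ennreal_power emeasure_lborel_Icc_eq power_0_left flip: less_top)
  finally show ?thesis .
qed

text \<open>Tonelli's theorem with \<open>i\<close> as the outer coordinate, for the induction on
  the dimension.\<close>

lemma PiM_insert_slice:
  assumes "finite I" "i \<notin> I" and [measurable]: "A \<in> sets (lborel_PiM (insert i I))"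
  shows measurable_PiM_insert_slice:
      "(\<lambda>y. emeasure (lborel_PiM I) {x \<in> space (lborel_PiM I). x(i := y) \<in> A}) \<in> borel_measurable borel"
    and sets_PiM_insert_slice: "\<And>y. {x \<in> space (lborel_PiM I). x(i := y) \<in> A} \<in> sets (lborel_PiM I)"
    and emeasure_PiM_insert_slice: "emeasure (lborel_PiM (insert i I)) A
      = (\<integral>\<^sup>+y. emeasure (lborel_PiM I) {x \<in> space (lborel_PiM I). x(i := y) \<in> A} \<partial>lborel)"
proof -
  interpret I: finite_product_sigma_finite "\<lambda>_. lborel :: real measure" I
    by standard fact
  show *: "{x \<in> space (lborel_PiM I). x(i := y) \<in> A} \<in> sets (lborel_PiM I)" for y
    by measurable
  have ind: "(\<integral>\<^sup>+x. indicator A (x(i := y)) \<partial>lborel_PiM I)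
    = emeasure (lborel_PiM I) {x \<in> space (lborel_PiM I). x(i := y) \<in> A}" for y
  proof -
    have "(\<integral>\<^sup>+x. indicator A (x(i := y)) \<partial>lborel_PiM I)
      = (\<integral>\<^sup>+x. indicator {x \<in> space (lborel_PiM I). x(i := y) \<in> A} x \<partial>lborel_PiM I)"
      by (intro nn_integral_cong) (auto simp: indicator_def)
    then show ?thesis
      by (simp only: nn_integral_indicator[OF *])
  qed
  show "emeasure (lborel_PiM (insert i I)) A
      = (\<integral>\<^sup>+y. emeasure (lborel_PiM I) {x \<in> space (lborel_PiM I). x(i := y) \<in> A} \<partial>lborel)"
    using assms(1,2) by (subst nn_integral_indicator[OF assms(3), symmetric])
       (subst lborel_product.product_nn_integral_insert_rev, auto simp: ind)
  have "(\<lambda>y. \<integral>\<^sup>+x. indicator A (x(i := y)) \<partial>lborel_PiM I) \<in> borel_measurable borel"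
    by (rule I.borel_measurable_nn_integral) measurable
  then show "(\<lambda>y. emeasure (lborel_PiM I) {x \<in> space (lborel_PiM I). x(i := y) \<in> A}) \<in> borel_measurable borel"
    by (simp only: ind)
qed

text \<open>Induction on the dimension: slice measures satisfy the hypothesis of
  \<open>prekopa_leindler_real\<close> by the induction hypothesis, and Tonelli identifies their
  integrals. The multiplicative form has exponents independent of the dimension, so it passes
  through the induction; the box makes the slice measures finite and bounded.\<close>

lemma brunn_minkowski_lborel_PiM:
  fixes A B C :: "('i \<Rightarrow> real) set"
  assumes "finite I" and t: "0 < t" "t < 1"
    and "A \<in> sets (lborel_PiM I)" "B \<in> sets (lborel_PiM I)" "C \<in> sets (lborel_PiM I)"
    and "A \<subseteq> (\<Pi>\<^sub>E i\<in>I. {- R..R})" "B \<subseteq> (\<Pi>\<^sub>E i\<in>I. {- R..R})" "C \<subseteq> (\<Pi>\<^sub>E i\<in>I. {- R..R})"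
    and "\<And>x y. x \<in> A \<Longrightarrow> y \<in> B \<Longrightarrow> (\<lambda>i\<in>I. (1 - t) * x i + t * y i) \<in> C"
  shows "measure (lborel_PiM I) A powr (1 - t) * measure (lborel_PiM I) B powr t
    \<le> measure (lborel_PiM I) C"
  using assms(1,4-)
proof (induction I arbitrary: A B C rule: finite_induct)
  case empty
  \<comment> \<open>The product over the empty index set is a single point of mass 1, so only
    emptiness matters.\<close>
  have cases: "D = {} \<or> D = {\<lambda>_. undefined}" if "D \<subseteq> (\<Pi>\<^sub>E i\<in>{}. {- R..R})" for D :: "('i \<Rightarrow> real) set"
    using that by auto
  show ?case
  proof (cases "A = {} \<or> B = {}")
    case False
    then obtain x y where "x \<in> A" "y \<in> B" by blast
    then have "C \<noteq> {}" using empty(7)[of x y] by blast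
    then have "A = {\<lambda>_. undefined}" "B = {\<lambda>_. undefined}" "C = {\<lambda>_. undefined}"
      using False cases empty(4-6) by blast+
    then show ?thesis by (simp add: PiM_empty measure_def)
  qed auto
next
  case (insert i I)
  define slice where "slice A y = {x \<in> space (lborel_PiM I). x(i := y) \<in> A}" for A y
  define \<phi> where "\<phi> A y = measure (lborel_PiM I) (slice A y)" for A y
  have box: "slice D y \<subseteq> (\<Pi>\<^sub>E i\<in>I. {- R..R})" if D: "D \<subseteq> (\<Pi>\<^sub>E i\<in>insert i I. {- R..R})" for D y
  proof
    fix x assume "x \<in> slice D y"
    then have "x \<in> extensional I" "x(i := y) \<in> (\<Pi>\<^sub>E i\<in>insert i I. {- R..R})"
      using D by (auto simp: slice_def space_PiM PiE_def)
    moreover have "x j \<in> {- R..R}" if "j \<in> I" for j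
      using PiE_mem[OF calculation(2), of j] that insert.hyps by (cases "j = i") auto
    ultimately show "x \<in> (\<Pi>\<^sub>E i\<in>I. {- R..R})" by (auto simp: PiE_iff)
  qed
  have emeas: "emeasure (lborel_PiM I) (slice D y) = ennreal (\<phi> D y)"
    if "D \<subseteq> (\<Pi>\<^sub>E i\<in>insert i I. {- R..R})" for D y
    unfolding \<phi>_def using emeasure_lborel_PiM_finite[OF insert.hyps(1) box[OF that, of y]]
    by (intro emeasure_eq_ennreal_measure) auto
  have props: "\<phi> D \<in> borel_measurable borel"
    "(\<integral>\<^sup>+y. \<phi> D y \<partial>lborel) = ennreal (measure (lborel_PiM (insert i I)) D)"
    "\<phi> D y \<le> measure (lborel_PiM I) (\<Pi>\<^sub>E i\<in>I. {- R..R})" "slice D y \<in> sets (lborel_PiM I)"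
    if D: "D \<in> sets (lborel_PiM (insert i I))" "D \<subseteq> (\<Pi>\<^sub>E i\<in>insert i I. {- R..R})" for D y
  proof -
    note sl = PiM_insert_slice[OF insert.hyps D(1), folded slice_def, unfolded emeas[OF D(2)]]
    show "slice D y \<in> sets (lborel_PiM I)" by (rule sl)
    show "\<phi> D \<in> borel_measurable borel"
      using borel_measurable_enn2real[OF sl(1)] by (simp add: \<phi>_def[abs_def])
    show "(\<integral>\<^sup>+y. \<phi> D y \<partial>lborel) = ennreal (measure (lborel_PiM (insert i I)) D)"
      unfolding sl(3)[symmetric] using emeasure_lborel_PiM_finite[OF _ D(2)] insert.hyps(1)
      by (intro emeasure_eq_ennreal_measure) auto
    show "\<phi> D y \<le> measure (lborel_PiM I) (\<Pi>\<^sub>E i\<in>I. {- R..R})"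
      unfolding \<phi>_def measure_def
      using insert.hyps(1) box[OF D(2)] emeasure_lborel_PiM_finite[OF insert.hyps(1) order_refl, of R]
      by (intro enn2real_mono emeasure_mono sets_PiM_I_finite) auto
  qed
  note pA = props[OF insert.prems(1,4)] and pB = props[OF insert.prems(2,5)]
    and pC = props[OF insert.prems(3,6)]
  show ?case
  proof (rule prekopa_leindler_real[where f = "\<phi> A" and g = "\<phi> B" and h = "\<phi> C"])
    fix y z :: real
    show "\<phi> A y powr (1 - t) * \<phi> B z powr t \<le> \<phi> C ((1 - t) * y + t * z)"
      unfolding \<phi>_def
    proof (rule insert.IH)
      fix u v assume uv: "u \<in> slice A y" "v \<in> slice B z"
      \<comment> \<open>Inserting the coordinate \<open>i\<close> commutes with convex combination,
        so slices of \<open>A\<close> at \<open>y\<close> and of \<open>B\<close> at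
        \<open>z\<close> combine into the slice of \<open>C\<close> at the mean height.\<close>
      have "(\<lambda>j\<in>insert i I. (1 - t) * (u(i := y)) j + t * (v(i := z)) j)
        = (\<lambda>j\<in>I. (1 - t) * u j + t * v j)(i := (1 - t) * y + t * z)"
        using insert.hyps by (auto simp: fun_eq_iff restrict_def)
      moreover have "(\<lambda>j\<in>insert i I. (1 - t) * (u(i := y)) j + t * (v(i := z)) j) \<in> C"
        using uv by (intro insert.prems(7)[of "u(i := y)" "v(i := z)"])
          (simp_all add: slice_def del: fun_upd_apply)
      ultimately have "(\<lambda>j\<in>I. (1 - t) * u j + t * v j)(i := (1 - t) * y + t * z) \<in> C"
        by (simp only:)
      then show "(\<lambda>j\<in>I. (1 - t) * u j + t * v j) \<in> slice C ((1 - t) * y + t * z)"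
        by (simp add: slice_def space_PiM del: fun_upd_apply)
    qed (rule pA pB pC box insert.prems)+
  qed (rule pA pB pC t | simp add: \<phi>_def)+
qed

section \<open>Slices by parallel hyperplanes\<close>

text \<open>The coordinates other than \<open>i\<close> are free; the \<open>i\<close>-th one is solved from \<open>z \<bullet> d = r\<close>.\<close>

definition hyperplane_point :: "'a::euclidean_space \<Rightarrow> 'a \<Rightarrow> ('a \<Rightarrow> real) \<Rightarrow> real \<Rightarrow> 'a" where
  "hyperplane_point d i x r = (\<Sum>j\<in>Basis - {i}. x j *\<^sub>R j)
    + ((r - (\<Sum>j\<in>Basis - {i}. x j * (d \<bullet> j))) / (d \<bullet> i)) *\<^sub>R i"

text \<open>For fixed free coordinates the \<open>i\<close>-th one is affine in the height
  \<open>r\<close> with slope \<open>1 / (d \<bullet> i)\<close>; this substitution and Tonelli give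
  the formula. Slices are measured through their projection along \<open>i\<close>, whence the
  factor \<open>\<bar>d \<bullet> i\<bar>\<close>.\<close>

lemma lborel_hyperplane_slices:
  fixes S :: "'a::euclidean_space set" and d i :: 'a
  assumes i: "i \<in> Basis" "d \<bullet> i \<noteq> 0" and [measurable]: "S \<in> sets borel"
  defines "I \<equiv> Basis - {i}"
  shows measurable_hyperplane_slice:
      "(\<lambda>r. emeasure (lborel_PiM I) {x \<in> space (lborel_PiM I). hyperplane_point d i x r \<in> S}) \<in> borel_measurable borel"
    and sets_hyperplane_slice: "\<And>r. {x \<in> space (lborel_PiM I). hyperplane_point d i x r \<in> S} \<in> sets (lborel_PiM I)"
    and emeasure_hyperplane_slices: "ennreal \<bar>d \<bullet> i\<bar> * emeasure lborel S
      = (\<integral>\<^sup>+r. emeasure (lborel_PiM I) {x \<in> space (lborel_PiM I). hyperplane_point d i x r \<in> S} \<partial>lborel)"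
proof -
  interpret I: finite_product_sigma_finite "\<lambda>_. lborel :: real measure" I
    by standard (simp add: I_def)
  interpret pair: pair_sigma_finite "lborel_PiM I" "lborel :: real measure"
    by standard
  define \<Phi> where "\<Phi> = hyperplane_point d i"
  have \<Phi>_eq: "\<Phi> x r = (\<Sum>j\<in>I. x j *\<^sub>R j)
    + ((r - (\<Sum>j\<in>I. x j * (d \<bullet> j))) / (d \<bullet> i)) *\<^sub>R i" for x r
    by (simp add: \<Phi>_def hyperplane_point_def I_def)
  let ?e = "\<lambda>f::'a \<Rightarrow> real. \<Sum>b\<in>Basis. f b *\<^sub>R b"
  have e[measurable]: "?e \<in> borel_measurable (lborel_PiM Basis)"
    by measurable
  have [measurable]: "(\<lambda>x. x j) \<in> borel_measurable (lborel_PiM I)" if "j \<in> I" for j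
    using measurable_component_singleton[OF that, of "\<lambda>_. lborel"] by simp
  have \<Phi>1[measurable]: "(\<lambda>x. \<Phi> x r) \<in> borel_measurable (lborel_PiM I)" for r
    unfolding \<Phi>_eq by measurable
  have \<Phi>2[measurable]: "(\<lambda>p. \<Phi> (fst p) (snd p)) \<in> borel_measurable (lborel_PiM I \<Otimes>\<^sub>M borel)"
    unfolding \<Phi>_eq by measurable
  have \<Phi>3[measurable]: "(\<lambda>p. \<Phi> (snd p) (fst p)) \<in> borel_measurable (borel \<Otimes>\<^sub>M lborel_PiM I)"
    unfolding \<Phi>_eq by measurable
  show *: "{x \<in> space (lborel_PiM I). \<Phi> x r \<in> S} \<in> sets (lborel_PiM I)" for r
    by measurable
  have ind: "(\<integral>\<^sup>+x. indicator S (\<Phi> x r) \<partial>lborel_PiM I)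
    = emeasure (lborel_PiM I) {x \<in> space (lborel_PiM I). \<Phi> x r \<in> S}" for r
  proof -
    have "(\<integral>\<^sup>+x. indicator S (\<Phi> x r) \<partial>lborel_PiM I)
      = (\<integral>\<^sup>+x. indicator {x \<in> space (lborel_PiM I). \<Phi> x r \<in> S} x \<partial>lborel_PiM I)"
      by (intro nn_integral_cong) (auto simp: indicator_def)
    then show ?thesis
      by (simp only: nn_integral_indicator[OF *])
  qed
  have "(\<lambda>r. \<integral>\<^sup>+x. indicator S (\<Phi> x r) \<partial>lborel_PiM I) \<in> borel_measurable borel"
    by (rule I.borel_measurable_nn_integral) measurable
  then show "(\<lambda>r. emeasure (lborel_PiM I) {x \<in> space (lborel_PiM I). \<Phi> x r \<in> S}) \<in> borel_measurable borel"
    by (simp only: ind)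
  have ins: "Basis = insert i I" "finite I" "i \<notin> I"
    using i by (auto simp: I_def)
  have upd: "?e (x(i := y)) = (\<Sum>j\<in>I. x j *\<^sub>R j) + y *\<^sub>R i" for x y
    unfolding ins(1) using ins(2,3)
    by (simp add: sum.insert add.commute) (intro sum.cong, auto)
  have "emeasure lborel S = (\<integral>\<^sup>+z. indicator S z \<partial>lborel)"
    by simp
  also have "\<dots> = (\<integral>\<^sup>+f. indicator S (?e f) \<partial>lborel_PiM Basis)"
    by (subst lborel_eq, subst nn_integral_distr) auto
  also have "\<dots> = (\<integral>\<^sup>+x. (\<integral>\<^sup>+y. indicator S (?e (x(i := y))) \<partial>lborel) \<partial>lborel_PiM I)"
    by (rule lborel_product.product_nn_integral_insert[OF ins(2,3), folded ins(1)]) measurable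
  also have "\<dots> = (\<integral>\<^sup>+x. ennreal \<bar>1 / (d \<bullet> i)\<bar> * (\<integral>\<^sup>+r. indicator S (\<Phi> x r) \<partial>lborel) \<partial>lborel_PiM I)"
  proof (intro nn_integral_cong)
    fix x
    let ?s = "\<Sum>j\<in>I. x j * (d \<bullet> j)"
    have "(\<integral>\<^sup>+y. indicator S (?e (x(i := y))) \<partial>lborel)
      = ennreal \<bar>1 / (d \<bullet> i)\<bar> * (\<integral>\<^sup>+r. indicator S (?e (x(i := - ?s / (d \<bullet> i) + 1 / (d \<bullet> i) * r))) \<partial>lborel)"
      using i by (intro nn_integral_real_affine) (auto simp: upd)
    moreover have "- ?s / (d \<bullet> i) + 1 / (d \<bullet> i) * r = (r - ?s) / (d \<bullet> i)" for r
      by (simp add: diff_divide_distrib)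
    ultimately show "(\<integral>\<^sup>+y. indicator S (?e (x(i := y))) \<partial>lborel)
      = ennreal \<bar>1 / (d \<bullet> i)\<bar> * (\<integral>\<^sup>+r. indicator S (\<Phi> x r) \<partial>lborel)"
      by (simp only: upd \<Phi>_eq)
  qed
  also have "\<dots> = ennreal \<bar>1 / (d \<bullet> i)\<bar> * (\<integral>\<^sup>+x. (\<integral>\<^sup>+r. indicator S (\<Phi> x r) \<partial>lborel) \<partial>lborel_PiM I)"
    by (intro nn_integral_cmult) measurable
  also have "(\<integral>\<^sup>+x. (\<integral>\<^sup>+r. indicator S (\<Phi> x r) \<partial>lborel) \<partial>lborel_PiM I)
    = (\<integral>\<^sup>+r. (\<integral>\<^sup>+x. indicator S (\<Phi> x r) \<partial>lborel_PiM I) \<partial>lborel)"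
    by (intro pair.Fubini'[symmetric]) measurable
  finally have "emeasure lborel S
    = ennreal \<bar>1 / (d \<bullet> i)\<bar> * (\<integral>\<^sup>+r. emeasure (lborel_PiM I) {x \<in> space (lborel_PiM I). \<Phi> x r \<in> S} \<partial>lborel)"
    by (simp only: ind)
  then show "ennreal \<bar>d \<bullet> i\<bar> * emeasure lborel S
      = (\<integral>\<^sup>+r. emeasure (lborel_PiM I) {x \<in> space (lborel_PiM I). \<Phi> x r \<in> S} \<partial>lborel)"
    using i by (simp add: mult.assoc[symmetric] flip: ennreal_mult)
qed

text \<open>Brunn--Minkowski compares the slices at heights \<open>x\<close> and \<open>y\<close>
  with the slice at \<open>x * y / D\<close>, and \<open>harmonic_mean_integral\<close> integrates
  this over the heights. Boundedness makes the slice measures finite and lets them vanish above a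
  fixed height.\<close>

lemma harmonic_mean_lborel:
  fixes A B C :: "'a::euclidean_space set" and d :: 'a
  assumes meas: "A \<in> sets borel" "B \<in> sets borel" "C \<in> sets borel"
    and bdd: "bounded A" "bounded B" "bounded C" and t: "0 < t" "t < 1"
    and pos: "\<And>z. z \<in> A \<union> B \<union> C \<Longrightarrow> 0 < z \<bullet> d"
    and C: "\<And>z w D. z \<in> A \<Longrightarrow> w \<in> B \<Longrightarrow> D = (1 - t) * (w \<bullet> d) + t * (z \<bullet> d) \<Longrightarrow>
      ((1 - t) * (w \<bullet> d) / D) *\<^sub>R z + (t * (z \<bullet> d) / D) *\<^sub>R w \<in> C"
    and AB: "0 < measure lborel A" "0 < measure lborel B"
  shows "measure lborel A * measure lborel B
    \<le> measure lborel C * ((1 - t) * measure lborel B + t * measure lborel A)"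
proof -
  have "A \<noteq> {}" using AB by auto
  then have "d \<noteq> 0" using pos by fastforce
  then obtain i where i: "i \<in> Basis" "d \<bullet> i \<noteq> 0"
    using euclidean_all_zero_iff by blast
  define I where "I = Basis - {i}"
  have ins: "Basis = insert i I" "finite I" "i \<notin> I"
    using i by (auto simp: I_def)
  define \<Phi> where "\<Phi> = hyperplane_point d i"
  have \<Phi>_eq: "\<Phi> x r = (\<Sum>j\<in>I. x j *\<^sub>R j)
    + ((r - (\<Sum>j\<in>I. x j * (d \<bullet> j))) / (d \<bullet> i)) *\<^sub>R i" for x r
    by (simp add: \<Phi>_def hyperplane_point_def I_def)
  define slice where "slice S r = {x \<in> space (lborel_PiM I). \<Phi> x r \<in> S}" for S r
  define \<phi> where "\<phi> S r = measure (lborel_PiM I) (slice S r)" for S r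
  obtain R where R: "\<And>z. z \<in> A \<union> B \<union> C \<Longrightarrow> norm z \<le> R"
    using bdd bounded_iff[of "A \<union> B \<union> C"] by auto
  have \<Phi>d: "\<Phi> x r \<bullet> d = r" for x r
    using i by (simp add: \<Phi>_eq inner_add_left inner_sum_left inner_commute[of d])
  have \<Phi>j: "\<Phi> x r \<bullet> j = x j" if "j \<in> I" for x r j
  proof -
    have "(\<Sum>k\<in>I. x k * (k \<bullet> j)) = (\<Sum>k\<in>I. if k = j then x k else 0)"
      using that i by (intro sum.cong) (auto simp: I_def inner_Basis)
    then show ?thesis
      using that i ins by (auto simp: \<Phi>_eq inner_add_left inner_sum_left inner_Basis I_def)
  qed
  \<comment> \<open>\<open>\<Phi>\<close> is affine in the free coordinates and the height jointly,
    so combining points of two slices combines both.\<close>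
  have \<Phi>_comb: "(1 - s) *\<^sub>R \<Phi> u x + s *\<^sub>R \<Phi> v y = \<Phi> (\<lambda>j\<in>I. (1 - s) * u j + s * v j) ((1 - s) * x + s * y)"
    for s u v x y
  proof -
    have 1: "(\<Sum>j\<in>I. (\<lambda>j\<in>I. (1 - s) * u j + s * v j) j *\<^sub>R j)
        = (1 - s) *\<^sub>R (\<Sum>j\<in>I. u j *\<^sub>R j) + s *\<^sub>R (\<Sum>j\<in>I. v j *\<^sub>R j)"
      by (simp add: scaleR_add_left scaleR_sum_right sum.distrib)
    have 2: "(\<Sum>j\<in>I. (\<lambda>j\<in>I. (1 - s) * u j + s * v j) j * (d \<bullet> j))
        = (1 - s) * (\<Sum>j\<in>I. u j * (d \<bullet> j)) + s * (\<Sum>j\<in>I. v j * (d \<bullet> j))"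
      by (simp add: distrib_right sum_distrib_left sum.distrib mult.assoc)
    show ?thesis
      unfolding \<Phi>_eq 1 2 using i
      by (simp add: scaleR_add_right add.assoc[symmetric] flip: scaleR_add_left)
         (simp add: algebra_simps add_divide_distrib diff_divide_distrib)
  qed
  have box: "slice S r \<subseteq> (\<Pi>\<^sub>E j\<in>I. {- R..R})" if S: "S \<subseteq> A \<union> B \<union> C" for S r
  proof
    fix x assume x: "x \<in> slice S r"
    have "x j \<in> {- R..R}" if j: "j \<in> I" for j
    proof -
      have "\<bar>\<Phi> x r \<bullet> j\<bar> \<le> norm (\<Phi> x r)"
        using j ins by (intro Basis_le_norm) auto
      then show ?thesis
        using R[of "\<Phi> x r"] x S \<Phi>j[OF j, of x r] by (auto simp: slice_def)
    qed
    then show "x \<in> (\<Pi>\<^sub>E j\<in>I. {- R..R})"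
      using x by (auto simp: slice_def space_PiM PiE_iff)
  qed
  have emeas: "emeasure (lborel_PiM I) (slice S r) = ennreal (\<phi> S r)" if "S \<subseteq> A \<union> B \<union> C" for S r
    unfolding \<phi>_def using emeasure_lborel_PiM_finite[OF ins(2) box[OF that, of r]]
    by (intro emeasure_eq_ennreal_measure) auto
  define b where "b = measure (lborel_PiM I) (\<Pi>\<^sub>E j\<in>I. {- R..R})"
  have props: "\<phi> S \<in> borel_measurable borel"
    "(\<integral>\<^sup>+r. \<phi> S r \<partial>lborel) = ennreal (\<bar>d \<bullet> i\<bar> * measure lborel S)"
    "\<phi> S r \<le> b" "slice S r \<in> sets (lborel_PiM I)"
    "r \<le> 0 \<Longrightarrow> \<phi> S r = 0" "R * norm d < r \<Longrightarrow> \<phi> S r = 0"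
    if S: "S \<in> sets borel" "S \<subseteq> A \<union> B \<union> C" "bounded S" for S r
  proof -
    note sl = lborel_hyperplane_slices[OF i S(1), folded I_def, folded \<Phi>_def,
        folded slice_def, unfolded emeas[OF S(2)]]
    show "slice S r \<in> sets (lborel_PiM I)" by (rule sl)
    show "\<phi> S \<in> borel_measurable borel"
      using borel_measurable_enn2real[OF sl(1)] by (simp add: \<phi>_def[abs_def])
    have "emeasure lborel S = ennreal (measure lborel S)"
      using emeasure_bounded_finite[OF S(3)] by (intro emeasure_eq_ennreal_measure) auto
    then show "(\<integral>\<^sup>+r. \<phi> S r \<partial>lborel) = ennreal (\<bar>d \<bullet> i\<bar> * measure lborel S)"
      unfolding sl(3)[symmetric] by (simp add: ennreal_mult)
    show "\<phi> S r \<le> b"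
      unfolding \<phi>_def b_def measure_def
      using ins(2) box[OF S(2)] emeasure_lborel_PiM_finite[OF ins(2) order_refl, of R]
      by (intro enn2real_mono emeasure_mono sets_PiM_I_finite) auto
    show "\<phi> S r = 0" if "r \<le> 0"
    proof -
      have "slice S r = {}"
        using that \<Phi>d pos S(2) by (fastforce simp: slice_def)
      then show ?thesis by (simp add: \<phi>_def)
    qed
    show "\<phi> S r = 0" if r: "R * norm d < r"
    proof -
      have "\<Phi> x r \<notin> S" for x
      proof
        assume "\<Phi> x r \<in> S"
        then have "norm (\<Phi> x r) * norm d \<le> R * norm d"
          using R S(2) by (intro mult_right_mono) auto
        then show False
          using r norm_cauchy_schwarz[of "\<Phi> x r" d] \<Phi>d[of x r] by linarith
      qed
      then have "slice S r = {}" by (simp add: slice_def)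
      then show ?thesis by (simp add: \<phi>_def)
    qed
  qed
  have "A \<subseteq> A \<union> B \<union> C" "B \<subseteq> A \<union> B \<union> C" "C \<subseteq> A \<union> B \<union> C"
    by auto
  note pA = props[OF meas(1) this(1) bdd(1)] and pB = props[OF meas(2) this(2) bdd(2)]
    and pC = props[OF meas(3) this(3) bdd(3)]
  let ?k = "\<bar>d \<bullet> i\<bar>"
  have "(?k * measure lborel A) * (?k * measure lborel B)
    \<le> (?k * measure lborel C) * ((1 - t) * (?k * measure lborel B) + t * (?k * measure lborel A))"
  proof (rule harmonic_mean_integral[where F = "\<phi> A" and G = "\<phi> B" and H = "\<phi> C"
        and b = b and R = "R * norm d"])
    fix x y D assume xy: "0 < x" "0 < y" and D: "D = (1 - t) * y + t * x"
    have "0 < D" using xy t D by (auto intro!: add_pos_pos)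
    \<comment> \<open>The weight varies with the heights: it is the one that sends the combined
      height to the weighted harmonic mean \<open>x * y / D\<close>.\<close>
    define s where "s = t * x / D"
    have s1: "(1 - t) * y / D = 1 - s"
      using \<open>0 < D\<close> D by (simp add: s_def field_simps)
    have s: "0 < s" "s < 1"
    proof -
      show "0 < s" using xy t \<open>0 < D\<close> by (simp add: s_def)
      have "0 < (1 - t) * y / D" using xy t \<open>0 < D\<close> by simp
      then show "s < 1" using s1 by linarith
    qed
    have "(1 - s) * x + s * y = (1 - t) * y / D * x + t * x / D * y"
      by (simp only: s1 s_def)
    also have "\<dots> = x * y / D"
      using \<open>0 < D\<close> by (simp add: field_simps)
    finally have xyD: "(1 - s) * x + s * y = x * y / D" .
    have "\<phi> A x powr (1 - s) * \<phi> B y powr s \<le> \<phi> C (x * y / D)"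
      unfolding \<phi>_def
    proof (rule brunn_minkowski_lborel_PiM[OF ins(2) s])
      fix u v assume uv: "u \<in> slice A x" "v \<in> slice B y"
      then have "(1 - s) *\<^sub>R \<Phi> u x + s *\<^sub>R \<Phi> v y \<in> C"
        using C[of "\<Phi> u x" "\<Phi> v y" D] by (simp add: slice_def \<Phi>d D[symmetric] s1 s_def[symmetric])
      then show "(\<lambda>j\<in>I. (1 - s) * u j + s * v j) \<in> slice C (x * y / D)"
        by (simp add: \<Phi>_comb xyD slice_def space_PiM)
    qed (rule pA(4) pB(4) pC(4) | rule box, blast)+
    then show "\<phi> A x powr ((1 - t) * y / D) * \<phi> B y powr (t * x / D) \<le> \<phi> C (x * y / D)"
      by (simp only: s1 s_def)
  qed (rule pA(1-4) pB(1-4) pC(1-4) t | erule pA(5-6) pB(5-6) pC(5-6) | simp add: \<phi>_def AB i)+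
  \<comment> \<open>Both sides are homogeneous of degree two in the volumes, so the projection
    factor cancels.\<close>
  then have "?k\<^sup>2 * (measure lborel A * measure lborel B)
    \<le> ?k\<^sup>2 * (measure lborel C * ((1 - t) * measure lborel B + t * measure lborel A))"
    by (simp add: power2_eq_square algebra_simps)
  then show ?thesis
    using i by simp
qed

section \<open>Strips\<close>

lemma lborel_distr_uminus_euclidean: "distr lborel borel uminus = (lborel :: 'a::euclidean_space measure)"
  using lborel_affine[of "-1" "0::'a"] by (simp add: density_1)

text \<open>Replacing \<open>x\<close> by the intermediate point raises the inner product with
  \<open>z\<close> by \<open>t * (z \<bullet> d)\<close>, and replacing \<open>y\<close> by it
  lowers that with \<open>w\<close> by \<open>(1 - t) * (w \<bullet> d)\<close>, where
  \<open>d = y - x\<close>. The weights are chosen so that these changes cancel, leaving a convex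
  combination of \<open>z \<bullet> x\<close> and \<open>w \<bullet> y\<close>.\<close>

lemma strip_set_convex_combination:
  fixes x y z w :: "real ^ 'n"
  assumes "convex K" and t: "0 < t" "t < 1"
    and z: "z \<in> strip_set K x" "0 < z \<bullet> (y - x)" and w: "w \<in> strip_set K y" "0 < w \<bullet> (y - x)"
    and D: "D = (1 - t) * (w \<bullet> (y - x)) + t * (z \<bullet> (y - x))"
  defines "v \<equiv> ((1 - t) * (w \<bullet> (y - x)) / D) *\<^sub>R z + (t * (z \<bullet> (y - x)) / D) *\<^sub>R w"
  shows "v \<in> strip_set K ((1 - t) *\<^sub>R x + t *\<^sub>R y) \<and> 0 < v \<bullet> (y - x)"
proof -
  define d where "d = y - x"
  define a b where "a = (1 - t) * (w \<bullet> d) / D" and "b = t * (z \<bullet> d) / D"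
  have v: "v = a *\<^sub>R z + b *\<^sub>R w"
    by (simp add: v_def a_def b_def d_def)
  have pos: "0 < z \<bullet> d" "0 < w \<bullet> d" using z w by (auto simp: d_def)
  then have "0 < D" using t by (auto simp: D d_def intro!: add_pos_pos)
  then have ab: "0 < a" "0 < b" "a + b = 1"
    using pos t by (auto simp: a_def b_def D d_def simp flip: add_divide_distrib)
  have "v \<in> K"
    unfolding v using assms ab by (intro convexD) (auto simp: strip_set_def)
  moreover have "0 < v \<bullet> d"
    unfolding v using ab pos by (simp add: inner_add_left add_pos_pos)
  moreover have "\<bar>v \<bullet> ((1 - t) *\<^sub>R x + t *\<^sub>R y)\<bar> \<le> 1"
  proof -
    have zx: "z \<bullet> ((1 - t) *\<^sub>R x + t *\<^sub>R y) = z \<bullet> x + t * (z \<bullet> d)"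
      and wy: "w \<bullet> ((1 - t) *\<^sub>R x + t *\<^sub>R y) = w \<bullet> y - (1 - t) * (w \<bullet> d)"
      by (simp_all add: d_def inner_diff_right inner_add_right algebra_simps)
    have cancel: "a * (t * (z \<bullet> d)) = b * ((1 - t) * (w \<bullet> d))"
      by (simp add: a_def b_def)
    have "v \<bullet> ((1 - t) *\<^sub>R x + t *\<^sub>R y) = a * (z \<bullet> x) + b * (w \<bullet> y)"
      unfolding v inner_add_left inner_scaleR_left zx wy distrib_left right_diff_distrib cancel
      by simp
    also have "\<bar>\<dots>\<bar> \<le> a * \<bar>z \<bullet> x\<bar> + b * \<bar>w \<bullet> y\<bar>"
      using ab by (intro order_trans[OF abs_triangle_ineq]) (simp add: abs_mult)
    also have "\<dots> \<le> a * 1 + b * 1"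
      using z w ab by (intro add_mono mult_left_mono) (auto simp: strip_set_def abs_square_le_1)
    finally show ?thesis using ab by simp
  qed
  ultimately show ?thesis
    by (simp add: strip_set_def abs_square_le_1 d_def)
qed

lemma compact_strip_set:
  fixes K :: "(real ^ 'n) set"
  assumes "compact K"
  shows "compact (strip_set K x)"
proof -
  have "strip_set K x = K \<inter> {z. 1 - \<bar>z \<bullet> x\<bar>\<^sup>2 \<ge> 0}"
    by (auto simp: strip_set_def)
  moreover have "closed {z. 1 - \<bar>z \<bullet> x\<bar>\<^sup>2 \<ge> 0}"
    by (intro closed_Collect_le continuous_intros)
  ultimately show ?thesis
    using assms by (simp add: compact_Int_closed)
qed

text \<open>Reflection in the origin preserves volume and exchanges the two open halves, while the
  separating hyperplane is null. The symmetry of \<open>K\<close> enters here.\<close>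

lemma measure_strip_set_half:
  fixes K :: "(real ^ 'n) set"
  assumes K: "compact K" "\<forall>z\<in>K. - z \<in> K" and "d \<noteq> 0"
  shows "measure lborel (strip_set K x) = 2 * measure lborel {z \<in> strip_set K x. 0 < z \<bullet> d}"
proof -
  let ?S = "strip_set K x"
  let ?P = "{z \<in> ?S. 0 < z \<bullet> d}" and ?N = "{z \<in> ?S. z \<bullet> d < 0}" and ?Z = "{z \<in> ?S. z \<bullet> d = 0}"
  have S[measurable]: "?S \<in> sets borel"
    using compact_strip_set[OF K(1)] by (simp add: borel_compact)
  have "emeasure lborel ?Z = 0"
  proof -
    have "emeasure lebesgue {z. d \<bullet> z = 0} = 0"
      using negligible_hyperplane[of d 0] \<open>d \<noteq> 0\<close> by (simp add: negligible_iff_emeasure0)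
    then have "emeasure lborel {z. d \<bullet> z = 0} = 0"
      by simp
    then show ?thesis
      by (rule emeasure_eq_0[rotated]) (auto simp: inner_commute)
  qed
  moreover have "emeasure lborel ?N = emeasure lborel ?P"
  proof -
    have "emeasure lborel ?P = emeasure lborel (uminus -` ?P)"
      by (subst (1) lborel_distr_uminus_euclidean[symmetric]) (simp add: emeasure_distr)
    moreover have "- z \<in> K \<longleftrightarrow> z \<in> K" for z
      using K(2) by (metis minus_minus)
    then have "uminus -` ?P = ?N"
      by (auto simp: strip_set_def)
    ultimately show ?thesis by simp
  qed
  moreover have "emeasure lborel ?S = emeasure lborel ?P + emeasure lborel (?N \<union> ?Z)"
    by (subst plus_emeasure) (auto intro!: arg_cong[where f = "emeasure lborel"])
  moreover have "emeasure lborel (?N \<union> ?Z) = emeasure lborel ?N + emeasure lborel ?Z"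
    by (subst plus_emeasure) auto
  moreover have "emeasure lborel ?P < \<infinity>"
    using bounded_subset[OF compact_imp_bounded[OF compact_strip_set[OF K(1), of x]], of ?P]
    by (intro emeasure_bounded_finite) auto
  ultimately show ?thesis
    by (simp add: measure_def enn2real_plus)
qed

text \<open>This removes the probability space: afterwards only volumes are compared, with the
  common factor \<open>measure lborel K\<close>.\<close>

lemma strip_prob_eq:
  assumes K: "compact K" and \<zeta>: "uniformly_distributed_on M \<zeta> K"
  shows "strip_prob M \<zeta> K x = measure lborel (strip_set K x) / measure lborel K"
proof -
  have [measurable]: "\<zeta> \<in> borel_measurable M" and d: "distr M lborel \<zeta> = uniform_measure lborel K"
    using \<zeta> by (auto simp: uniformly_distributed_on_def)
  have [measurable]: "strip_set K x \<in> sets borel" "K \<in> sets borel"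
    using compact_strip_set[OF K] K by (auto simp: borel_compact)
  have fin: "emeasure lborel A = ennreal (measure lborel A)" if "compact A" for A :: "(real ^ 'n) set"
    using emeasure_compact_finite[OF that] by (intro emeasure_eq_ennreal_measure) auto
  have "strip_prob M \<zeta> K x = measure (distr M lborel \<zeta>) (strip_set K x)"
    by (subst measure_distr) (auto simp: strip_prob_def intro!: arg_cong[where f = "measure M"])
  also have "\<dots> = enn2real (emeasure lborel (K \<inter> strip_set K x) / emeasure lborel K)"
    unfolding d measure_def by (subst emeasure_uniform_measure) auto
  also have "K \<inter> strip_set K x = strip_set K x"
    by (auto simp: strip_set_def)
  also have "enn2real (emeasure lborel (strip_set K x) / emeasure lborel K)
    = measure lborel (strip_set K x) / measure lborel K"
  proof (cases "measure lborel K = 0")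
    \<comment> \<open>If \<open>K\<close> is null, so is the strip, and both quotients are 0 by the
      conventions for division by 0.\<close>
    case True
    then have "emeasure lborel K = 0" using fin[OF K] by simp
    then have "emeasure lborel (strip_set K x) = 0"
      by (rule emeasure_eq_0[rotated]) (auto simp: strip_set_def)
    then show ?thesis using True by simp
  next
    case False
    then have "0 < measure lborel K" by (simp add: zero_less_measure_iff)
    then show ?thesis
      by (simp add: fin K compact_strip_set divide_ennreal)
  qed
  finally show ?thesis .
qed

section \<open>Convexity of the reciprocal probability and transfer of optimizers\<close>

theorem theorem2:
  fixes M :: "'w measure"
    and \<zeta> :: "'w \<Rightarrow> real ^ 'n"
    and K X :: "(real ^ 'n) set"
    and f h :: "real ^ 'n \<Rightarrow> real"
    and \<epsilon> :: real
  assumes "compact K" and "convex K" and "\<forall>z\<in>K. - z \<in> K"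
    and "prob_space M" and "uniformly_distributed_on M \<zeta> K"
    and "closed X" and "convex X" and "bounded X"
    and "f = strip_prob M \<zeta> K"
    and "\<epsilon> > 0" and "\<forall>x\<in>X. f x \<in> {\<epsilon>..1}"
    and "h = (\<lambda>x. 1 / f x)"
  shows "convex_on X h \<and>
         (\<forall>x. is_arg_max f (\<lambda>y. y \<in> X) x \<longrightarrow> is_arg_min h (\<lambda>y. y \<in> X) x)"
proof
  have pos: "0 < f x" if "x \<in> X" for x
    using assms(10,11) that by force
  show "convex_on X h"
  proof (rule convex_onI)
    fix t :: real and x y
    assume t: "0 < t" "t < 1" and xy: "x \<in> X" "y \<in> X"
    let ?z = "(1 - t) *\<^sub>R x + t *\<^sub>R y"
    have z: "?z \<in> X"
      using \<open>convex X\<close> xy t by (intro convexD) auto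
    show "h ?z \<le> (1 - t) * h x + t * h y"
    proof (cases "x = y")
      \<comment> \<open>For \<open>x = y\<close> the direction \<open>d\<close> would be 0 and the
        half-strips empty, so this case is settled directly.\<close>
      case True
      then have "?z = x" "(1 - t) * h x + t * h y = h x"
        by (simp_all add: left_diff_distrib flip: scaleR_add_left)
      then show ?thesis by simp
    next
      case False
      define d where "d = y - x"
      have "d \<noteq> 0" using False by (simp add: d_def)
      let ?P = "\<lambda>u. {v \<in> strip_set K u. 0 < v \<bullet> d}"
      let ?k = "measure lborel K"
      have f: "f u * ?k = 2 * measure lborel (?P u)" if "u \<in> X" for u
        using pos[OF that] measure_strip_set_half[OF assms(1,3) \<open>d \<noteq> 0\<close>, of u]
          strip_prob_eq[OF assms(1,5), of u] unfolding assms(9) by auto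
      \<comment> \<open>A null \<open>K\<close> would give \<open>f x = 0\<close>, since the
        quotient in \<open>strip_prob_eq\<close> would have denominator 0.\<close>
      have "?k \<noteq> 0"
        using pos[OF xy(1)] strip_prob_eq[OF assms(1,5), of x] unfolding assms(9) by auto
      then have k: "0 < ?k"
        by (simp add: zero_less_measure_iff)
      have P: "0 < measure lborel (?P u)" if "u \<in> X" for u
      proof -
        have "0 < f u * ?k" using pos[OF that] k by simp
        then show ?thesis using f[OF that] by simp
      qed
      have meas: "?P u \<in> sets borel" "bounded (?P u)" for u
      proof -
        have [measurable]: "strip_set K u \<in> sets borel"
          using compact_strip_set[OF assms(1)] by (simp add: borel_compact)
        show "?P u \<in> sets borel" by measurable
        show "bounded (?P u)"
          using compact_imp_bounded[OF compact_strip_set[OF assms(1)]]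
          by (rule bounded_subset) auto
      qed
      have "measure lborel (?P x) * measure lborel (?P y)
        \<le> measure lborel (?P ?z) * ((1 - t) * measure lborel (?P y) + t * measure lborel (?P x))"
      proof (rule harmonic_mean_lborel[where d = d, OF meas(1) meas(1) meas(1) meas(2) meas(2) meas(2) t])
        fix z w D
        assume "z \<in> ?P x" "w \<in> ?P y" "D = (1 - t) * (w \<bullet> d) + t * (z \<bullet> d)"
        then show "((1 - t) * (w \<bullet> d) / D) *\<^sub>R z + (t * (z \<bullet> d) / D) *\<^sub>R w \<in> ?P ?z"
          using strip_set_convex_combination[OF assms(2) t, of z x y w D] by (simp add: d_def)
      qed (use P xy in auto)
      \<comment> \<open>Doubling every half-strip volume scales both sides by 4 and turns each half
        into \<open>f u * ?k\<close>.\<close>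
      then have "(2 * measure lborel (?P x)) * (2 * measure lborel (?P y))
        \<le> (2 * measure lborel (?P ?z)) * ((1 - t) * (2 * measure lborel (?P y)) + t * (2 * measure lborel (?P x)))"
        by (simp add: algebra_simps)
      then have "?k\<^sup>2 * (f x * f y) \<le> ?k\<^sup>2 * (f ?z * ((1 - t) * f y + t * f x))"
        unfolding f[OF xy(1), symmetric] f[OF xy(2), symmetric] f[OF z, symmetric]
        by (simp add: power2_eq_square algebra_simps)
      then have *: "f x * f y \<le> f ?z * ((1 - t) * f y + t * f x)"
        using k by simp
      \<comment> \<open>Dividing by the positive values of \<open>f\<close> turns the harmonic-mean
        bound on \<open>f\<close> into convexity of its reciprocal.\<close>
      have "1 / f ?z \<le> ((1 - t) * f y + t * f x) / (f x * f y)"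
        using * pos[OF xy(1)] pos[OF xy(2)] pos[OF z]
        by (simp add: divide_le_eq pos_le_divide_eq mult.commute)
      also have "\<dots> = (1 - t) * (1 / f x) + t * (1 / f y)"
        using pos[OF xy(1)] pos[OF xy(2)] by (simp add: field_simps)
      finally show ?thesis by (simp add: assms(12))
    qed
  qed fact
  show "\<forall>x. is_arg_max f (\<lambda>y. y \<in> X) x \<longrightarrow> is_arg_min h (\<lambda>y. y \<in> X) x"
  proof (intro allI impI)
    fix x assume "is_arg_max f (\<lambda>y. y \<in> X) x"
    then have x: "x \<in> X" and max: "\<And>y. y \<in> X \<Longrightarrow> f y \<le> f x"
      unfolding is_arg_max_def by (simp, meson not_less)
    \<comment> \<open>On positive values the reciprocal reverses order.\<close>
    have "h x \<le> h y" if "y \<in> X" for y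
      using max[OF that] pos[OF that] unfolding assms(12) by (intro divide_left_mono) auto
    then show "is_arg_min h (\<lambda>y. y \<in> X) x"
      using x unfolding is_arg_min_def by (meson not_less)
  qed
qed

end
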